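(* Consider the coupled initial value problem $$\dot y_S=f_S(t,y_S,y_F),\quad y_S(t_0)=y_{S,0},\qquad \dot y_F=f_F(t,y_S,y_F),\quad y_F(t_0)=y_{F,0},\qquad t\in(t_0,t_{\mathrm{end}}],$$ with $y_S(t)\in\mathbb{R}^{m_S}$, $y_F(t)\in\mathbb{R}^{m_F}$, where $f_S$ and $f_F$ are continuous and Lipschitz continuous with respect to $(y_S,y_F)$. Let $p\ge 1$ be an integer and let $m\in\mathbb{N}$ be a fixed multirate factor. Suppose two basic integration schemes of order $p$ are used: one for $y_S$ with a single step of macro step size $H$, and one for $y_F$ with $m$ steps of micro step size $h=H/m$. Suppose these are combined in the fastest-first multirate approach on each macro step $[\bar t,\bar t+H]\subseteq[t_0,t_{\mathrm{end}}]$: the coupling variable $y_S$ in the fast subsystem is evaluated by an extrapolation procedure of order $p-1$, and the coupling variable $y_F$ in the slow subsystem is evaluated by an interpolation procedure of order $p-1$ (instead of extrapolation) based on the fast data already computed in the current macro step. Then the resulting fastest-first multirate scheme has (consistency) order $p$ on the macro step level, i.e. $$\|y_{S,H}(\bar t+H)-y_S(\bar t+H)\|=\mathcal{O}(H^{p+1}),\qquad \|y_{F,H}(\bar t+H)-y_F(\bar t+H)\|=\mathcal{O}(H^{p+1})\quad (H\to 0),$$ where $(y_S,y_F)$ is the exact solution of the coupled system through the data at $\bar t$ and $(y_{S,H},y_{F,H})$ is the multirate numerical solution started from the same data.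
   Context: One macro step. At time $\bar t$ data $y_S(\bar t)=y_{S,\bar t}$, $y_F(\bar t)=y_{F,\bar t}$ are given; $(y_S(t),y_F(t))$ denotes the unique exact solution of the coupled system on $[\bar t,\bar t+H]$ with these data. Extrapolation of order $p-1$ for $y_S$: a known (continuous) function $\tilde y_S$ on $[\bar t,\bar t+H]$, built from information available at $\bar t$ (or from the preceding macro step), with $\|y_S(t)-\tilde y_S(t)\|\le L_S H^p+\mathcal{O}(H^{p+1})$ for all $t\in[\bar t,\bar t+H]$, with a constant $L_S>0$ independent of $H$. Fastest-first approach. First $m$ micro steps of the fast basic scheme are applied over $[\bar t,\bar t+H]$ to $\dot y_F=f_F(t,\tilde y_S(t),y_F)$, $y_F(\bar t)=y_{F,\bar t}$. Then one macro step of the slow basic scheme is applied to $\dot y_S=f_S(t,y_S,y_F^{int}(t))$, $y_S(\bar t)=y_{S,\bar t}$, where $y_F^{int}$ is a (continuous) interpolated waveform built from the numerical fast approximations $y_{F,H}(t_k)$, $t_k\in[\bar t,\bar t+H]$. Let $\hat y_F,\hat y_S$ denote the exact solutions of these two modified initial value problems, and $y_{F,H}(\bar t+H)$, $y_{S,H}(\bar t+H)$ the numerical results. Interpolation of order $p-1$: $\|\hat y_F(t)-y_F^{int}(t)\|\le \tilde L_F H^p+\mathcal{O}(H^{p+1})$ for all $t\in[\bar t,\bar t+H]$, with $\tilde L_F>0$ independent of $H$. Basic integration scheme of order $p$: the scheme for a subsystem with given coupling data has order $p$, i.e. applied to the modified (decoupled) subsystems above one has $\|y_{S,H}(\bar t+H)-\hat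 y_S(\bar t+H)\|\le c_S H^{p+1}+\mathcal{O}(H^{p+2})$ and $\|y_{F,H}(\bar t+H)-\hat y_F(\bar t+H)\|\le c_F H^{p+1}+\mathcal{O}(H^{p+2})$, with constants $c_S,c_F>0$ independent of $H$. *)

theory Defs
  imports "HOL-Analysis.Analysis" "HOL-Library.Landau_Symbols"
begin

definition ivp_solution ::
  "(real \<Rightarrow> 'a \<Rightarrow> 'a) \<Rightarrow> real \<Rightarrow> real \<Rightarrow> 'a::real_normed_vector \<Rightarrow> (real \<Rightarrow> 'a) \<Rightarrow> bool" where
  "ivp_solution g a b y0 y \<longleftrightarrow>
     y a = y0 \<and> (\<forall>t\<in>{a..b}. (y has_vector_derivative g t (y t)) (at t within {a..b}))"

text \<open>
  A one-step scheme maps a right-hand side, a current time, a current state and a step size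
  to the next state. No particular method is fixed.
\<close>

type_synonym 'a scheme = "(real \<Rightarrow> 'a \<Rightarrow> 'a) \<Rightarrow> real \<Rightarrow> 'a \<Rightarrow> real \<Rightarrow> 'a"

primrec scheme_steps :: "'a scheme \<Rightarrow> (real \<Rightarrow> 'a \<Rightarrow> 'a) \<Rightarrow> real \<Rightarrow> 'a \<Rightarrow> real \<Rightarrow> nat \<Rightarrow> 'a" where
  "scheme_steps \<Phi> g a y0 h 0 = y0"
| "scheme_steps \<Phi> g a y0 h (Suc k) = \<Phi> g (a + real k * h) (scheme_steps \<Phi> g a y0 h k) h"

text \<open>
  In the next two definitions everything is indexed by the macro step size \<open>H\<close>, which ranges
  over all values with \<open>[a, a + H] \<subseteq> [a, b]\<close>; constants and remainders do not depend on \<open>t\<close>.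
  Order \<open>q\<close> of a waveform means an error \<open>L H\<^sup>q\<^sup>+\<^sup>1 + O(H\<^sup>q\<^sup>+\<^sup>2)\<close>, uniformly on the macro step.
\<close>

definition waveform_order ::
  "nat \<Rightarrow> real \<Rightarrow> real \<Rightarrow> (real \<Rightarrow> real \<Rightarrow> 'a::real_normed_vector) \<Rightarrow> (real \<Rightarrow> real \<Rightarrow> 'a) \<Rightarrow> bool" where
  "waveform_order q a b y w \<longleftrightarrow>
     (\<exists>L>0. \<exists>r\<in>O[at_right 0](\<lambda>H. H ^ (q + 2)). \<forall>H\<in>{0<..b - a}. \<forall>t\<in>{a..a + H}.
        norm (y H t - w H t) \<le> L * H ^ (q + 1) + r H)"

text \<open>
  \<open>num H\<close> is the numerical value at \<open>a + H\<close>, and \<open>y H\<close> the exact solution of the (in general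
  \<open>H\<close>-dependent) decoupled problem that the scheme is applied to.
\<close>

definition scheme_order ::
  "nat \<Rightarrow> real \<Rightarrow> real \<Rightarrow> (real \<Rightarrow> 'a::real_normed_vector) \<Rightarrow> (real \<Rightarrow> real \<Rightarrow> 'a) \<Rightarrow> bool" where
  "scheme_order p a b num y \<longleftrightarrow>
     (\<exists>c>0. \<exists>r\<in>O[at_right 0](\<lambda>H. H ^ (p + 2)). \<forall>H\<in>{0<..b - a}.
        norm (num H - y H (a + H)) \<le> c * H ^ (p + 1) + r H)"

end

theory Submission
  imports Defs
begin

text \<open>
  On a single macro step an exact solution of the coupled system and the exact solution of a
  decoupled subsystem start from the same value and solve the same equation up to the coupling
  error. The maximal distance \<open>M\<close> of the two thus satisfies \<open>M \<le> H L (M + \<delta>)\<close> for a coupling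
  error \<open>\<delta>\<close>, so \<open>M \<le> 2 L \<delta> H\<close> as soon as \<open>L H \<le> 1/2\<close>: decoupling gains one power of \<open>H\<close>.
  Applied to the fast subsystem, an extrapolation error \<open>O(H\<^sup>p)\<close> yields an error \<open>O(H\<^sup>p\<^sup>+\<^sup>1)\<close>
  of the fast waveform, so the interpolated fast waveform is still \<open>O(H\<^sup>p)\<close>-close to the
  exact one, and the same estimate then applies to the slow subsystem.
\<close>

lemma norm_le_of_derivative_le_affine:
  fixes d d' :: "real \<Rightarrow> 'a::real_normed_vector"
  assumes deriv: "\<And>t. t \<in> {a..a + H} \<Longrightarrow> (d has_vector_derivative d' t) (at t within {a..a + H})"
    and init: "d a = 0"
    and le: "\<And>t. t \<in> {a..a + H} \<Longrightarrow> norm (d' t) \<le> L * (norm (d t) + \<delta>)"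
    and "0 \<le> L" "0 \<le> \<delta>" and small: "L * H \<le> 1 / 2"
    and t: "t \<in> {a..a + H}"
  shows "norm (d t) \<le> 2 * L * \<delta> * H"
proof -
  have H: "0 \<le> H" using t by simp
  have "continuous_on {a..a + H} (\<lambda>t. norm (d t))"
    using deriv by (intro continuous_intros) (metis has_vector_derivative_continuous continuous_on_eq_continuous_within)
  then obtain s where s: "s \<in> {a..a + H}" and max: "\<And>t. t \<in> {a..a + H} \<Longrightarrow> norm (d t) \<le> norm (d s)"
    using continuous_attains_sup[of "{a..a + H}" "\<lambda>t. norm (d t)"] H by auto
  \<comment> \<open>Because \<open>s\<close> maximises the distance, \<open>B\<close> bounds
    \<open>norm (d' t)\<close> on the whole interval. The bound depending on \<open>d\<close> thus
    becomes a constant one, and the mean value inequality replaces a Gronwall argument.\<close>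
  define B where "B = L * (norm (d s) + \<delta>)"
  have "norm (d s - d a) \<le> B * norm (s - a)"
  proof (rule differentiable_bound)
    show "convex {a..a + H}" by simp
    show "(d has_derivative (\<lambda>h. h *\<^sub>R d' t)) (at t within {a..a + H})" if "t \<in> {a..a + H}" for t
      using deriv[OF that] by (simp add: has_vector_derivative_def)
    show "onorm (\<lambda>h. h *\<^sub>R d' t) \<le> B" if "t \<in> {a..a + H}" for t
    proof (rule onorm_le)
      fix h :: real
      have "norm (d' t) \<le> B"
        unfolding B_def using le[OF that] max[OF that] \<open>0 \<le> L\<close>
        by (meson add_right_mono mult_left_mono order_trans)
      then show "norm (h *\<^sub>R d' t) \<le> B * norm h"
        by (simp add: mult.commute[of B] mult_left_mono)
    qed
  qed (use s H in auto)
  also have "\<dots> \<le> B * H"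
    using s \<open>0 \<le> L\<close> \<open>0 \<le> \<delta>\<close> by (intro mult_left_mono) (auto simp: B_def)
  finally have "norm (d s) \<le> L * H * norm (d s) + L * \<delta> * H"
    using init by (simp add: B_def algebra_simps)
  \<comment> \<open>Half of \<open>norm (d s)\<close> is absorbed into the left-hand side, which
    produces the factor 2.\<close>
  moreover have "L * H * norm (d s) \<le> 1 / 2 * norm (d s)"
    using small by (intro mult_right_mono) auto
  ultimately show ?thesis using max[OF t] by linarith
qed

lemma eventually_at_right_0_le: "b > (0::real) \<Longrightarrow> eventually (\<lambda>H. H \<in> {0<..b}) (at_right 0)"
  by (auto simp: eventually_at_right_field intro!: exI[of _ b])

text \<open>For \<open>H\<close> at most 1 the power \<open>H ^ Suc n\<close> is below
  \<open>H ^ n\<close>, so the remainder only enlarges the leading constant. This reduces both order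
  definitions to a single eventual bound. The sign of \<open>C\<close> is left open.\<close>

lemma bigo_remainder_absorbed:
  fixes r :: "real \<Rightarrow> real"
  assumes "r \<in> O[at_right 0](\<lambda>H. H ^ Suc n)"
  obtains C where "eventually (\<lambda>H. L * H ^ n + r H \<le> C * H ^ n) (at_right 0)"
proof -
  from landau_o.bigE[OF assms] obtain c where c: "c > 0"
    "eventually (\<lambda>H. norm (r H) \<le> c * norm (H ^ Suc n)) (at_right 0)" .
  have "eventually (\<lambda>H. L * H ^ n + r H \<le> (L + c) * H ^ n) (at_right 0)"
    using c(2) eventually_at_right_0_le[of 1, OF zero_less_one]
  proof eventually_elim
    case (elim H)
    have "c * H ^ Suc n \<le> c * H ^ n"
      using elim(2) c(1) by (intro mult_left_mono power_decreasing) auto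
    moreover have "norm (H ^ Suc n) = H ^ Suc n"
      using elim(2) by simp
    ultimately have "r H \<le> c * H ^ n"
      using elim(1) by simp
    then show ?case by (simp add: algebra_simps)
  qed
  then show thesis by (rule that)
qed

lemma waveform_order_bound:
  assumes "waveform_order q a b y w" "a < b"
  obtains C where
    "eventually (\<lambda>H. \<forall>t\<in>{a..a + H}. norm (y H t - w H t) \<le> C * H ^ Suc q) (at_right 0)"
proof -
  have ba: "0 < b - a" using assms(2) by simp
  from assms(1) obtain L r where r: "r \<in> O[at_right 0](\<lambda>H. H ^ Suc (Suc q))"
    and le: "\<forall>H\<in>{0<..b - a}. \<forall>t\<in>{a..a + H}. norm (y H t - w H t) \<le> L * H ^ Suc q + r H"
    unfolding waveform_order_def by auto
  from r obtain C where C: "eventually (\<lambda>H. L * H ^ Suc q + r H \<le> C * H ^ Suc q) (at_right 0)"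
    by (rule bigo_remainder_absorbed)
  have "eventually (\<lambda>H. \<forall>t\<in>{a..a + H}. norm (y H t - w H t) \<le> C * H ^ Suc q) (at_right 0)"
    using C eventually_at_right_0_le[OF ba]
    by eventually_elim (use le in \<open>blast intro: order_trans\<close>)
  then show thesis by (rule that)
qed

lemma scheme_order_bound:
  assumes "scheme_order p a b num y" "a < b"
  obtains C where "eventually (\<lambda>H. norm (num H - y H (a + H)) \<le> C * H ^ Suc p) (at_right 0)"
proof -
  have ba: "0 < b - a" using assms(2) by simp
  from assms(1) obtain L r where r: "r \<in> O[at_right 0](\<lambda>H. H ^ Suc (Suc p))"
    and le: "\<forall>H\<in>{0<..b - a}. norm (num H - y H (a + H)) \<le> L * H ^ Suc p + r H"
    unfolding scheme_order_def by auto
  from r obtain C where C: "eventually (\<lambda>H. L * H ^ Suc p + r H \<le> C * H ^ Suc p) (at_right 0)"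
    by (rule bigo_remainder_absorbed)
  have "eventually (\<lambda>H. norm (num H - y H (a + H)) \<le> C * H ^ Suc p) (at_right 0)"
    using C eventually_at_right_0_le[OF ba]
    by eventually_elim (use le in \<open>blast intro: order_trans\<close>)
  then show thesis by (rule that)
qed

text \<open>The norm of a pair is at most the sum of the norms of its components. The sum separates
  the error in the unknown from the error in the coupling variable.\<close>

lemma lipschitz_on_pair_norm_le:
  assumes "L-lipschitz_on UNIV (\<lambda>(u, v). g u v)"
  shows "norm (g u v - g u' v') \<le> L * (norm (u - u') + norm (v - v'))"
proof -
  have "norm (g u v - g u' v') \<le> L * norm ((u, v) - (u', v'))"
    using lipschitz_onD[OF assms, of "(u, v)" "(u', v')"] by (simp add: dist_norm)
  also have "\<dots> \<le> L * (norm (u - u') + norm (v - v'))"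
    using lipschitz_on_nonneg[OF assms] norm_Pair_le[of "u - u'" "v - v'"]
    by (intro mult_left_mono) auto
  finally show ?thesis .
qed

text \<open>On each macro step the maximum argument applies with coupling error
  \<open>C * H ^ p\<close>. The arguments of \<open>g\<close> are time, unknown and coupling
  variable, so that both subsystems are instances.\<close>

lemma decoupling_error:
  fixes g :: "real \<Rightarrow> 'a::real_normed_vector \<Rightarrow> 'b::real_normed_vector \<Rightarrow> 'a"
  assumes "a < b" "0 \<le> L"
    and lip: "\<And>t u v u' v'. t \<in> {a..b} \<Longrightarrow>
      norm (g t u v - g t u' v') \<le> L * (norm (u - u') + norm (v - v'))"
    and y: "ivp_solution (\<lambda>t u. g t u (z t)) a b y0 y"
    and w: "\<And>H. H \<in> {0<..b - a} \<Longrightarrow> ivp_solution (\<lambda>t u. g t u (c H t)) a (a + H) y0 (w H)"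
    and coupling: "eventually (\<lambda>H. \<forall>t\<in>{a..a + H}. norm (z t - c H t) \<le> C * H ^ p) (at_right 0)"
  shows "eventually (\<lambda>H. \<forall>t\<in>{a..a + H}. norm (y t - w H t) \<le> 2 * L * C * H ^ Suc p) (at_right 0)"
proof -
  \<comment> \<open>The first threshold makes \<open>L * H\<close> at most 1/2, with
    \<open>L + 1\<close> avoiding a division by zero; the second keeps the macro step inside
    \<open>{a..b}\<close>.\<close>
  have "0 < 1 / (2 * (L + 1))" "0 < b - a" using \<open>0 \<le> L\<close> \<open>a < b\<close> by simp_all
  from coupling this[THEN eventually_at_right_0_le]
  show ?thesis
  proof eventually_elim
    case (elim H)
    note H = elim(2,3)
    have "L * H \<le> (L + 1) * H" using H by simp
    also have "\<dots> \<le> 1 / 2" using H \<open>0 \<le> L\<close> by (simp add: field_simps)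
    finally have small: "L * H \<le> 1 / 2" .
    \<comment> \<open>No sign of \<open>C\<close> is assumed, but the bound at \<open>t = a\<close>
      dominates a norm.\<close>
    have nonneg: "0 \<le> C * H ^ p"
      using elim(1) H by (auto dest!: bspec[of _ _ a] intro: order_trans[OF norm_ge_zero])
    show ?case
    proof
      fix t assume t: "t \<in> {a..a + H}"
      have "norm (y t - w H t) \<le> 2 * L * (C * H ^ p) * H"
      proof (rule norm_le_of_derivative_le_affine
          [where d = "\<lambda>t. y t - w H t" and d' = "\<lambda>t. g t (y t) (z t) - g t (w H t) (c H t)"])
        fix s assume s: "s \<in> {a..a + H}"
        then have sb: "s \<in> {a..b}" using H by auto
        have "(y has_vector_derivative g s (y s) (z s)) (at s within {a..b})"
          using y sb by (simp add: ivp_solution_def)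
        then have "(y has_vector_derivative g s (y s) (z s)) (at s within {a..a + H})"
          by (rule has_vector_derivative_within_subset) (use H in auto)
        then show "((\<lambda>t. y t - w H t) has_vector_derivative
            g s (y s) (z s) - g s (w H s) (c H s)) (at s within {a..a + H})"
          using w[of H] H s by (intro has_vector_derivative_diff) (auto simp: ivp_solution_def)
        have "norm (g s (y s) (z s) - g s (w H s) (c H s))
            \<le> L * (norm (y s - w H s) + norm (z s - c H s))"
          by (rule lip[OF sb])
        also have "\<dots> \<le> L * (norm (y s - w H s) + C * H ^ p)"
          using elim(1) s \<open>0 \<le> L\<close> by (intro mult_left_mono add_left_mono) auto
        finally show "norm (g s (y s) (z s) - g s (w H s) (c H s))
            \<le> L * (norm (y s - w H s) + C * H ^ p)" .
      next
        show "y a - w H a = 0"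
          using y w[of H] H by (simp add: ivp_solution_def)
      qed (use t small nonneg \<open>0 \<le> L\<close> in auto)
      then show "norm (y t - w H t) \<le> 2 * L * C * H ^ Suc p"
        by (simp add: algebra_simps)
    qed
  qed
qed

text \<open>The error splits at \<open>w H (a + H)\<close>, the exact solution of the decoupled
  problem, into the error of the basic scheme and the decoupling error, both of size
  \<open>H ^ Suc p\<close>.\<close>

lemma scheme_error_bigo:
  assumes num: "scheme_order p a b num w" and "a < b"
    and w: "eventually (\<lambda>H. \<forall>t\<in>{a..a + H}. norm (y t - w H t) \<le> D * H ^ Suc p) (at_right 0)"
  shows "(\<lambda>H. norm (num H - y (a + H))) \<in> O[at_right 0](\<lambda>H. H ^ (p + 1))"
proof -
  from num \<open>a < b\<close> obtain C
    where C: "eventually (\<lambda>H. norm (num H - w H (a + H)) \<le> C * H ^ Suc p) (at_right 0)"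
    by (rule scheme_order_bound)
  show ?thesis
  proof (rule landau_o.bigI)
    \<comment> \<open>The Landau constant must be positive, while \<open>C\<close> and
      \<open>D\<close> may have any sign.\<close>
    show "0 < \<bar>C + D\<bar> + 1" by simp
    show "eventually (\<lambda>H. norm (norm (num H - y (a + H))) \<le> (\<bar>C + D\<bar> + 1) * norm (H ^ (p + 1)))
        (at_right 0)"
      using C w eventually_at_right_0_le[of 1, OF zero_less_one]
    proof eventually_elim
      case (elim H)
      have "norm (num H - y (a + H)) \<le> norm (num H - w H (a + H)) + norm (y (a + H) - w H (a + H))"
        using norm_triangle_ineq4[of "num H - w H (a + H)" "y (a + H) - w H (a + H)"] by simp
      also have "\<dots> \<le> C * H ^ Suc p + D * H ^ Suc p"
        using elim by (intro add_mono) auto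
      also have "\<dots> = (C + D) * H ^ Suc p"
        by (simp only: distrib_right)
      also have "\<dots> \<le> (\<bar>C + D\<bar> + 1) * H ^ Suc p"
        using elim(3) by (intro mult_right_mono) auto
      finally show ?case using elim(3) by simp
    qed
  qed
qed

theorem corollary5:
  fixes f\<^sub>S :: "real \<Rightarrow> real ^ 's \<Rightarrow> real ^ 'f \<Rightarrow> real ^ 's"
    and f\<^sub>F :: "real \<Rightarrow> real ^ 's \<Rightarrow> real ^ 'f \<Rightarrow> real ^ 'f"
    and \<Phi>\<^sub>S :: "(real ^ 's) scheme" and \<Phi>\<^sub>F :: "(real ^ 'f) scheme"
    and interp :: "real \<Rightarrow> (real \<times> (real ^ 'f)) list \<Rightarrow> real \<Rightarrow> real ^ 'f"
    and ybar\<^sub>S :: "real ^ 's" and ybar\<^sub>F :: "real ^ 'f"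
    and y\<^sub>S :: "real \<Rightarrow> real ^ 's" and y\<^sub>F :: "real \<Rightarrow> real ^ 'f"
    and yext\<^sub>S yhat\<^sub>S :: "real \<Rightarrow> real \<Rightarrow> real ^ 's"
    and yint\<^sub>F yhat\<^sub>F :: "real \<Rightarrow> real \<Rightarrow> real ^ 'f"
    and num\<^sub>S :: "real \<Rightarrow> real ^ 's" and num\<^sub>F :: "real \<Rightarrow> nat \<Rightarrow> real ^ 'f"
    and t\<^sub>0 t\<^sub>e\<^sub>n\<^sub>d tbar :: real and p m :: nat
  assumes "p \<ge> 1" and "m \<ge> 1"
    and "t\<^sub>0 \<le> tbar" and "tbar < t\<^sub>e\<^sub>n\<^sub>d"
    and "continuous_on ({t\<^sub>0..t\<^sub>e\<^sub>n\<^sub>d} \<times> UNIV) (\<lambda>(t, u, v). f\<^sub>S t u v)"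
    and "continuous_on ({t\<^sub>0..t\<^sub>e\<^sub>n\<^sub>d} \<times> UNIV) (\<lambda>(t, u, v). f\<^sub>F t u v)"
    and "\<exists>L. \<forall>t\<in>{t\<^sub>0..t\<^sub>e\<^sub>n\<^sub>d}. L-lipschitz_on UNIV (\<lambda>(u, v). f\<^sub>S t u v)"
    and "\<exists>L. \<forall>t\<in>{t\<^sub>0..t\<^sub>e\<^sub>n\<^sub>d}. L-lipschitz_on UNIV (\<lambda>(u, v). f\<^sub>F t u v)"
    \<comment> \<open>exact solution of the coupled system through the data at \<open>tbar\<close>\<close>
    and "ivp_solution (\<lambda>t (u, v). (f\<^sub>S t u v, f\<^sub>F t u v)) tbar t\<^sub>e\<^sub>n\<^sub>d (ybar\<^sub>S, ybar\<^sub>F) (\<lambda>t. (y\<^sub>S t, y\<^sub>F t))"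
    \<comment> \<open>extrapolation of the slow variable\<close>
    and "\<forall>H\<in>{0<..t\<^sub>e\<^sub>n\<^sub>d - tbar}. continuous_on {tbar..tbar + H} (yext\<^sub>S H)"
    and "waveform_order (p - 1) tbar t\<^sub>e\<^sub>n\<^sub>d (\<lambda>H. y\<^sub>S) yext\<^sub>S"
    \<comment> \<open>fast subsystem: exact solution of the modified problem, and micro steps of size \<open>H / m\<close>\<close>
    and "\<forall>H\<in>{0<..t\<^sub>e\<^sub>n\<^sub>d - tbar}.
           ivp_solution (\<lambda>t v. f\<^sub>F t (yext\<^sub>S H t) v) tbar (tbar + H) ybar\<^sub>F (yhat\<^sub>F H)"
    and "\<forall>H\<in>{0<..t\<^sub>e\<^sub>n\<^sub>d - tbar}. \<forall>k\<le>m.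
           num\<^sub>F H k = scheme_steps \<Phi>\<^sub>F (\<lambda>t v. f\<^sub>F t (yext\<^sub>S H t) v) tbar ybar\<^sub>F (H / real m) k"
    and "scheme_order p tbar t\<^sub>e\<^sub>n\<^sub>d (\<lambda>H. num\<^sub>F H m) yhat\<^sub>F"
    \<comment> \<open>interpolation of the fast variable from the computed micro step values\<close>
    and "\<forall>H\<in>{0<..t\<^sub>e\<^sub>n\<^sub>d - tbar}.
           yint\<^sub>F H = interp H (map (\<lambda>k. (tbar + real k * (H / real m), num\<^sub>F H k)) [0..<Suc m])"
    and "\<forall>H\<in>{0<..t\<^sub>e\<^sub>n\<^sub>d - tbar}. continuous_on {tbar..tbar + H} (yint\<^sub>F H)"
    and "waveform_order (p - 1) tbar t\<^sub>e\<^sub>n\<^sub>d yhat\<^sub>F yint\<^sub>F"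
    \<comment> \<open>slow subsystem: exact solution of the modified problem, and one macro step of size \<open>H\<close>\<close>
    and "\<forall>H\<in>{0<..t\<^sub>e\<^sub>n\<^sub>d - tbar}.
           ivp_solution (\<lambda>t u. f\<^sub>S t u (yint\<^sub>F H t)) tbar (tbar + H) ybar\<^sub>S (yhat\<^sub>S H)"
    and "\<forall>H\<in>{0<..t\<^sub>e\<^sub>n\<^sub>d - tbar}. num\<^sub>S H = \<Phi>\<^sub>S (\<lambda>t u. f\<^sub>S t u (yint\<^sub>F H t)) tbar ybar\<^sub>S H"
    and "scheme_order p tbar t\<^sub>e\<^sub>n\<^sub>d num\<^sub>S yhat\<^sub>S"
  shows "(\<lambda>H. norm (num\<^sub>S H - y\<^sub>S (tbar + H))) \<in> O[at_right 0](\<lambda>H. H ^ (p + 1)) \<and>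
         (\<lambda>H. norm (num\<^sub>F H m - y\<^sub>F (tbar + H))) \<in> O[at_right 0](\<lambda>H. H ^ (p + 1))"
proof -
  note tb = \<open>t\<^sub>0 \<le> tbar\<close> \<open>tbar < t\<^sub>e\<^sub>n\<^sub>d\<close>
  have p: "Suc (p - 1) = p" using \<open>p \<ge> 1\<close> by simp
  obtain L\<^sub>S where L\<^sub>S: "\<forall>t\<in>{t\<^sub>0..t\<^sub>e\<^sub>n\<^sub>d}. L\<^sub>S-lipschitz_on UNIV (\<lambda>(u, v). f\<^sub>S t u v)"
    using assms(7) by blast
  obtain L\<^sub>F where L\<^sub>F: "\<forall>t\<in>{t\<^sub>0..t\<^sub>e\<^sub>n\<^sub>d}. L\<^sub>F-lipschitz_on UNIV (\<lambda>(u, v). f\<^sub>F t u v)"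
    using assms(8) by blast
  have L_nonneg: "0 \<le> L\<^sub>S" "0 \<le> L\<^sub>F"
    using L\<^sub>S L\<^sub>F tb by (auto dest!: bspec[of _ _ tbar] intro: lipschitz_on_nonneg)
  \<comment> \<open>Each component of the coupled solution solves its own subsystem with the other
    component as a given coupling function, which is the form \<open>decoupling_error\<close>
    compares with.\<close>
  have exact\<^sub>S: "ivp_solution (\<lambda>t u. f\<^sub>S t u (y\<^sub>F t)) tbar t\<^sub>e\<^sub>n\<^sub>d ybar\<^sub>S y\<^sub>S"
    and exact\<^sub>F: "ivp_solution (\<lambda>t v. f\<^sub>F t (y\<^sub>S t) v) tbar t\<^sub>e\<^sub>n\<^sub>d ybar\<^sub>F y\<^sub>F"
    using assms(9)
    by (fastforce simp: ivp_solution_def has_vector_derivative_def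
        dest: has_derivative_fst has_derivative_snd)+

  from assms(11) tb(2) obtain C where
    "eventually (\<lambda>H. \<forall>t\<in>{tbar..tbar + H}. norm (y\<^sub>S t - yext\<^sub>S H t) \<le> C * H ^ Suc (p - 1)) (at_right 0)"
    by (rule waveform_order_bound)
  then have ext: "eventually (\<lambda>H. \<forall>t\<in>{tbar..tbar + H}. norm (y\<^sub>S t - yext\<^sub>S H t) \<le> C * H ^ p) (at_right 0)"
    unfolding p .
  have lip\<^sub>F: "norm (f\<^sub>F t u v - f\<^sub>F t u' v') \<le> L\<^sub>F * (norm (v - v') + norm (u - u'))"
    if "t \<in> {tbar..t\<^sub>e\<^sub>n\<^sub>d}" for t u v u' v'
    using lipschitz_on_pair_norm_le[OF L\<^sub>F[rule_format]] that tb by (simp add: add.commute)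
  \<comment> \<open>The unknown of the fast subsystem is the second state argument of
    \<open>f\<^sub>F\<close>, hence the swapped instance of \<open>g\<close>.\<close>
  have fast: "eventually (\<lambda>H. \<forall>t\<in>{tbar..tbar + H}. norm (y\<^sub>F t - yhat\<^sub>F H t) \<le> 2 * L\<^sub>F * C * H ^ Suc p)
      (at_right 0)"
    by (rule decoupling_error[where g = "\<lambda>t v u. f\<^sub>F t u v", OF tb(2) L_nonneg(2) lip\<^sub>F exact\<^sub>F _ ext])
      (use assms(12) in auto)

  from assms(17) tb(2) obtain C' where
    int: "eventually (\<lambda>H. \<forall>t\<in>{tbar..tbar + H}. norm (yhat\<^sub>F H t - yint\<^sub>F H t) \<le> C' * H ^ Suc (p - 1)) (at_right 0)"
    by (rule waveform_order_bound)
  \<comment> \<open>Interpolation is accurate relative to \<open>yhat\<^sub>F\<close>, not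
    \<open>y\<^sub>F\<close>. The additional distance between these two is one power of
    \<open>H\<close> smaller, so the order \<open>p\<close> of the coupling error survives.\<close>
  have coupling: "eventually (\<lambda>H. \<forall>t\<in>{tbar..tbar + H}. norm (y\<^sub>F t - yint\<^sub>F H t)
      \<le> (\<bar>2 * L\<^sub>F * C\<bar> + C') * H ^ p) (at_right 0)"
    using int[unfolded p] fast eventually_at_right_0_le[of 1, OF zero_less_one]
  proof eventually_elim
    case (elim H)
    show ?case
    proof
      fix t assume t: "t \<in> {tbar..tbar + H}"
      have "norm (y\<^sub>F t - yint\<^sub>F H t) \<le> norm (y\<^sub>F t - yhat\<^sub>F H t) + norm (yhat\<^sub>F H t - yint\<^sub>F H t)"
        using norm_triangle_ineq[of "y\<^sub>F t - yhat\<^sub>F H t" "yhat\<^sub>F H t - yint\<^sub>F H t"] by simp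
      also have "\<dots> \<le> 2 * L\<^sub>F * C * H ^ Suc p + C' * H ^ p"
        using elim(1,2) t by (intro add_mono) auto
      \<comment> \<open>Lowering the power uses \<open>H\<close> at most 1 and a nonnegative factor,
        hence the absolute value.\<close>
      also have "2 * L\<^sub>F * C * H ^ Suc p \<le> \<bar>2 * L\<^sub>F * C\<bar> * H ^ p"
        using elim(3) by (intro mult_mono power_decreasing) auto
      finally show "norm (y\<^sub>F t - yint\<^sub>F H t) \<le> (\<bar>2 * L\<^sub>F * C\<bar> + C') * H ^ p"
        by (simp add: distrib_right)
    qed
  qed
  have lip\<^sub>S: "norm (f\<^sub>S t u v - f\<^sub>S t u' v') \<le> L\<^sub>S * (norm (u - u') + norm (v - v'))"
    if "t \<in> {tbar..t\<^sub>e\<^sub>n\<^sub>d}" for t u v u' v'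
    using lipschitz_on_pair_norm_le[OF L\<^sub>S[rule_format]] that tb by simp
  have slow: "eventually (\<lambda>H. \<forall>t\<in>{tbar..tbar + H}. norm (y\<^sub>S t - yhat\<^sub>S H t)
      \<le> 2 * L\<^sub>S * (\<bar>2 * L\<^sub>F * C\<bar> + C') * H ^ Suc p) (at_right 0)"
    by (rule decoupling_error[where g = f\<^sub>S, OF tb(2) L_nonneg(1) lip\<^sub>S exact\<^sub>S _ coupling])
      (use assms(18) in auto)
  show ?thesis
    using scheme_error_bigo[OF assms(20) tb(2) slow] scheme_error_bigo[OF assms(14) tb(2) fast]
    by blast
qed

end
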